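(* Let $k\ge3$. The weights $c_{ij}=1$ for $i<j$ and renormalization factors $r_i=r=\frac{k(k-2)}{k^2-k-1}$ for all $i\in\mathsf{X}_k$ are a solution to the renormalization problem for $(K^{(k)},\mathsf{X}_k,\{F_i\}_{i\in\mathsf{X}_k})$.
   Context: Let $\mathsf{X}_k=\{0,\dots,k-1\}$. Let $p_0,\dots,p_{k-1}$ be the vertices of a regular simplex in $\mathbb{R}^{k-1}$ (with $k$ vertices), and let $q_i=\frac1{k-1}\sum_{j\neq i}p_j$. For $i\in\mathsf{X}_k$ let $F_i:\mathbb{R}^{k-1}\to\mathbb{R}^{k-1}$ be the unique affine map with $F_i(p_i)=p_i$ and $F_i(p_j)=q_j$ for $j\ne i$; each $F_i$ is a contraction. $K^{(k)}$ is the unique nonempty compact set with $K^{(k)}=\bigcup_{i\in\mathsf{X}_k}F_i(K^{(k)})$. Set $V_0=\{p_i: i\in\mathsf{X}_k\}$ and $V_{m+1}=\bigcup_{i\in\mathsf{X}_k}F_i(V_m)$ for $m\ge 0$ (so $V_m\subset V_{m+1}$). Given positive weights $\{c_{ij}: i<j\}$, define for $u:V_0\to\mathbb{R}$ the energy $\mathcal{E}_0(u)=\sum_{i<j}c_{ij}(u(p_i)-u(p_j))^2$. The weights $\{c_{ij}\}$ together with positive renormalization factors $\{r_i\}_{i=0}^{k-1}$ solve the renormalization problem if there are energies $\mathcal{E}_m$ on functions on $V_m$ ($m\ge1$) such that for every $m\ge1$: (E1) $\mathcal{E}_m(u)=\sum_{i=0}^{k-1}r_i^{-1}\mathcal{E}_{m-1}(u\circ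 F_i)$ for every $u:V_m\to\mathbb{R}$; and (E2) for every $u:V_{m-1}\to\mathbb{R}$, if $\tilde u:V_m\to\mathbb{R}$ is the extension of $u$ (i.e. $\tilde u|_{V_{m-1}}=u$) minimizing $\mathcal{E}_m$ among all extensions of $u$ to $V_m$, then $\mathcal{E}_m(\tilde u)=\mathcal{E}_{m-1}(u)$. *)

theory Defs
  imports "HOL-Analysis.Analysis"
begin

text \<open>The index set \<open>{0, \<dots>, k - 1}\<close> is rendered as \<open>{..<k}\<close>; values of families
  indexed by \<^typ>\<open>nat\<close> at indices \<open>\<ge> k\<close> are irrelevant.\<close>

definition regular_simplex_vertices :: "nat \<Rightarrow> (nat \<Rightarrow> 'a::euclidean_space) \<Rightarrow> bool" where
  "regular_simplex_vertices k p \<longleftrightarrow>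
     inj_on p {..<k} \<and> \<not> affine_dependent (p ` {..<k}) \<and>
     (\<exists>d. \<forall>i<k. \<forall>j<k. i \<noteq> j \<longrightarrow> dist (p i) (p j) = d)"

definition opposite_centroid :: "nat \<Rightarrow> (nat \<Rightarrow> 'a::real_vector) \<Rightarrow> nat \<Rightarrow> 'a" where
  "opposite_centroid k p i = (1 / real (k - 1)) *\<^sub>R (\<Sum>j\<in>{..<k} - {i}. p j)"

definition affine_map :: "('a::real_vector \<Rightarrow> 'b::real_vector) \<Rightarrow> bool" where
  "affine_map f \<longleftrightarrow> (\<exists>L c. linear L \<and> (\<forall>x. f x = L x + c))"

text \<open>If \<open>p\<close> enumerates \<open>k\<close> affinely independent points of a space of dimension \<open>k - 1\<close>, then
  this determines every \<open>F i\<close> with \<open>i < k\<close> uniquely.\<close>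

definition simplex_maps ::
    "nat \<Rightarrow> (nat \<Rightarrow> 'a::real_vector) \<Rightarrow> (nat \<Rightarrow> 'a \<Rightarrow> 'a) \<Rightarrow> bool" where
  "simplex_maps k p F \<longleftrightarrow>
     (\<forall>i<k. affine_map (F i) \<and> F i (p i) = p i \<and>
        (\<forall>j<k. j \<noteq> i \<longrightarrow> F i (p j) = opposite_centroid k p j))"

definition self_similar_set ::
    "nat \<Rightarrow> (nat \<Rightarrow> 'a::topological_space \<Rightarrow> 'a) \<Rightarrow> 'a set \<Rightarrow> bool" where
  "self_similar_set k F K \<longleftrightarrow> compact K \<and> K \<noteq> {} \<and> K = (\<Union>i<k. F i ` K)"

primrec level_vertices ::
    "nat \<Rightarrow> (nat \<Rightarrow> 'a) \<Rightarrow> (nat \<Rightarrow> 'a \<Rightarrow> 'a) \<Rightarrow> nat \<Rightarrow> 'a set" where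
  "level_vertices k p F 0 = p ` {..<k}"
| "level_vertices k p F (Suc m) = (\<Union>i<k. F i ` level_vertices k p F m)"

definition initial_energy ::
    "nat \<Rightarrow> (nat \<Rightarrow> 'a) \<Rightarrow> (nat \<Rightarrow> nat \<Rightarrow> real) \<Rightarrow> ('a \<Rightarrow> real) \<Rightarrow> real" where
  "initial_energy k p c u = (\<Sum>j<k. \<Sum>i<j. c i j * (u (p i) - u (p j))\<^sup>2)"

text \<open>A function on \<open>V\<close> is an element of \<open>V \<rightarrow>\<^sub>E UNIV\<close>, so that it carries no information
  outside \<open>V\<close>.\<close>

definition minimizing_extension ::
    "'a set \<Rightarrow> 'a set \<Rightarrow> (('a \<Rightarrow> real) \<Rightarrow> real) \<Rightarrow> ('a \<Rightarrow> real) \<Rightarrow> ('a \<Rightarrow> real) \<Rightarrow> bool" where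
  "minimizing_extension A B \<E> u v \<longleftrightarrow>
     is_arg_min \<E> (\<lambda>w. w \<in> B \<rightarrow>\<^sub>E UNIV \<and> restrict w A = u) v"

text \<open>\<open>compose V u f\<close> is the function \<open>u \<circ> f\<close> on \<open>V\<close>. The existence and
  uniqueness of the minimizing extension, presupposed when one speaks of ``the'' minimizing
  extension, is part of the second condition.\<close>

definition renormalization_solution ::
    "nat \<Rightarrow> (nat \<Rightarrow> 'a) \<Rightarrow> (nat \<Rightarrow> 'a \<Rightarrow> 'a) \<Rightarrow> (nat \<Rightarrow> nat \<Rightarrow> real) \<Rightarrow> (nat \<Rightarrow> real) \<Rightarrow> bool" where
  "renormalization_solution k p F c r \<longleftrightarrow>
     (let V = level_vertices k p F in
       (\<forall>j<k. \<forall>i<j. 0 < c i j) \<and> (\<forall>i<k. 0 < r i) \<and>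
       (\<exists>\<E> :: nat \<Rightarrow> ('a \<Rightarrow> real) \<Rightarrow> real.
         (\<forall>u \<in> V 0 \<rightarrow>\<^sub>E UNIV. \<E> 0 u = initial_energy k p c u) \<and>
         (\<forall>m. \<forall>u \<in> V (Suc m) \<rightarrow>\<^sub>E UNIV.
            \<E> (Suc m) u = (\<Sum>i<k. inverse (r i) * \<E> m (compose (V m) u (F i)))) \<and>
         (\<forall>m. \<forall>u \<in> V m \<rightarrow>\<^sub>E UNIV.
            (\<exists>!v. minimizing_extension (V m) (V (Suc m)) (\<E> (Suc m)) u v) \<and>
            (\<forall>v. minimizing_extension (V m) (V (Suc m)) (\<E> (Suc m)) u v \<longrightarrow>
               \<E> (Suc m) v = \<E> m u))))"

end

theory Submission
  imports Defs
begin

text \<open>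
  The argument separates into a computation on the first level and a gluing principle that
  carries it to all levels.

  \<^bold>\<open>First level.\<close> The \<open>i\<close>-th cell has the vertices \<open>p\<^sub>i\<close> and \<open>q\<^sub>j\<close> for \<open>j \<noteq> i\<close>. With prescribed values
  \<open>x\<^sub>i\<close> at \<open>p\<^sub>i\<close>, the sum of the \<open>k\<close> cell energies is a quadratic polynomial in the values \<open>y\<^sub>j\<close> at the
  points \<open>q\<^sub>j\<close>. Its critical point is \<open>h\<^sub>j = ((k - 1) \<Sum>x - x\<^sub>j) / (k\<^sup>2 - k - 1)\<close>, and
  completing the square turns it into \<open>r \<E>\<^sub>0(x)\<close> plus a positive definite form in \<open>y - h\<close>
  (lemma \<open>sum_cell_energies\<close>). This is where the value of \<open>r\<close> comes from. Because the points
  \<open>p\<^sub>i\<close>, \<open>q\<^sub>j\<close> are pairwise distinct, the values \<open>y\<^sub>j\<close> can be chosen freely, and the minimum is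
  attained exactly at \<open>y = h\<close> (lemma \<open>strict_renormalization_0\<close>).

  \<^bold>\<open>Gluing.\<close> The energy on level \<open>m + 2\<close> is a weighted sum of energies on level \<open>m + 1\<close>, one for
  every cell. Given \<open>u\<close> on \<open>V\<^sub>m\<^sub>+\<^sub>1\<close>, one minimizes in each cell separately. The cell minimizers
  combine to one function on \<open>V\<^sub>m\<^sub>+\<^sub>2\<close> as soon as two cells meet only in points whose values are
  already prescribed by \<open>u\<close>; the resulting function is then the unique minimizer, and its energy
  is the energy of \<open>u\<close> (lemma \<open>strict_renormalization_Suc\<close>).

  \<^bold>\<open>Overlaps.\<close> Let \<open>\<Delta>\<close> be the simplex spanned by the \<open>p\<^sub>i\<close>. For \<open>k > 3\<close> the cells \<open>F\<^sub>i(\<Delta>)\<close> and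
  \<open>F\<^sub>j(\<Delta>)\<close> share a face of positive dimension, so that the smallness of the overlap is a property
  of the sets \<open>V\<^sub>m\<close> and not of the simplices. In barycentric
  coordinates, \<open>F\<^sub>i(v) = F\<^sub>j(w)\<close> with \<open>i \<noteq> j\<close> forces the \<open>i\<close>-th and the \<open>j\<close>-th coordinates of
  \<open>v\<close> and of \<open>w\<close> to vanish (lemma \<open>cell_weights_overlap\<close>); but a point of any \<open>V\<^sub>m\<close> with two
  vanishing coordinates is one of the vertices \<open>p\<^sub>l\<close> (lemma \<open>level_vertices_two_zero_weights\<close>).
\<close>

section \<open>Barycentric coordinates\<close>

definition barycentric :: "nat \<Rightarrow> (nat \<Rightarrow> 'a::real_vector) \<Rightarrow> (nat \<Rightarrow> real) \<Rightarrow> 'a" where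
  "barycentric k p x = (\<Sum>i<k. x i *\<^sub>R p i)"

definition simplex_weights :: "nat \<Rightarrow> (nat \<Rightarrow> real) set" where
  "simplex_weights k = {x. (\<forall>i<k. 0 \<le> x i) \<and> (\<Sum>i<k. x i) = 1}"

text \<open>The map \<open>F\<^sub>i\<close> in barycentric coordinates; see \<open>simplex_maps_barycentric\<close>.\<close>

definition cell_weights :: "nat \<Rightarrow> nat \<Rightarrow> (nat \<Rightarrow> real) \<Rightarrow> nat \<Rightarrow> real" where
  "cell_weights k i x l =
     (1 - x i - x l + (if l = i then real k * x i else 0)) / (real k - 1)"

lemma barycentric_inject:
  fixes p :: "nat \<Rightarrow> 'a::real_vector"
  assumes "inj_on p {..<k}" and "\<not> affine_dependent (p ` {..<k})"
    and "(\<Sum>i<k. x i) = 1" and "(\<Sum>i<k. y i) = 1"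
    and "barycentric k p x = barycentric k p y" and "i < k"
  shows "x i = y i"
proof (rule ccontr)
  assume ne: "x i \<noteq> y i"
  \<comment> \<open>The difference of the two weight families, carried over to the points \<open>p\<^sub>j\<close>, is an affine dependence.\<close>
  define U where "U = (\<lambda>a. (x (the_inv_into {..<k} p a) - y (the_inv_into {..<k} p a)))"
  have U: "U (p j) = x j - y j" if "j < k" for j
    using that assms(1) by (simp add: U_def the_inv_into_f_f)
  have "sum U (p ` {..<k}) = (\<Sum>j<k. x j - y j)"
    using assms(1) by (simp add: sum.reindex U)
  hence "sum U (p ` {..<k}) = 0"
    using assms(3,4) by (simp add: sum_subtractf)
  moreover have "(\<Sum>a\<in>p ` {..<k}. U a *\<^sub>R a) = (\<Sum>j<k. (x j - y j) *\<^sub>R p j)"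
    using assms(1) by (simp add: sum.reindex U)
  hence "(\<Sum>a\<in>p ` {..<k}. U a *\<^sub>R a) = 0"
    using assms(5) by (simp add: barycentric_def scaleR_diff_left sum_subtractf)
  moreover have "U (p i) \<noteq> 0" using ne U assms(6) by simp
  ultimately have "affine_dependent (p ` {..<k})"
    using assms(6) by (subst affine_dependent_explicit_finite) auto
  with assms(2) show False by blast
qed

lemma barycentric_vertex:
  assumes "x i = 1" and "\<And>j. j < k \<Longrightarrow> j \<noteq> i \<Longrightarrow> x j = 0" and "i < k"
  shows "barycentric k p x = p i"
proof -
  have "(\<Sum>j<k. x j *\<^sub>R p j) = (\<Sum>j<k. if j = i then p i else 0)"
    using assms by (intro sum.cong) auto
  also have "\<dots> = p i" using assms(3) by (simp add: sum.delta)
  finally show ?thesis by (simp add: barycentric_def)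
qed

lemma opposite_centroid_eq:
  assumes "i < k"
  shows "opposite_centroid k p i = (1 / (real k - 1)) *\<^sub>R ((\<Sum>j<k. p j) - p i)"
  using assms by (simp add: opposite_centroid_def sum_diff1 of_nat_diff)

text \<open>With \<open>P\<close> the sum of all vertices, \<open>F\<^sub>i(p\<^sub>j) = (P - p\<^sub>j) / (k - 1)\<close> for \<open>j \<noteq> i\<close>, and \<open>F\<^sub>i(p\<^sub>i)\<close>
  differs from the same expression by \<open>(k p\<^sub>i - P) / (k - 1)\<close>. Hence \<open>F\<^sub>i\<close> sends a point \<open>v\<close> with
  weights \<open>x\<close> to \<open>(P - v + x\<^sub>i (k p\<^sub>i - P)) / (k - 1)\<close>, from which the weights of the image are read off.\<close>

lemma simplex_maps_barycentric:
  fixes p :: "nat \<Rightarrow> 'a::real_vector"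
  assumes "simplex_maps k p F" and "2 \<le> k" and "i < k" and x: "(\<Sum>j<k. x j) = 1"
  shows "F i (barycentric k p x) = barycentric k p (cell_weights k i x)"
proof -
  obtain L c where L: "linear L" and F: "\<And>v. F i v = L v + c"
    using assms(1,3) unfolding simplex_maps_def affine_map_def by blast
  define d where "d = real k - 1"
  have d: "d \<noteq> 0" "real k = d + 1" using assms(2) by (auto simp: d_def)
  define P where "P = (\<Sum>j<k. p j)"
  define B where "B = barycentric k p x"
  have Fp: "F i (p j) = (1 / d) *\<^sub>R (P - p j) + (if j = i then (1 / d) *\<^sub>R (real k *\<^sub>R p i - P) else 0)"
    if "j < k" for j
  proof (cases "j = i")
    case True
    have "(1 / d) *\<^sub>R (P - p i) + (1 / d) *\<^sub>R (real k *\<^sub>R p i - P) = (1 / d) *\<^sub>R ((real k - 1) *\<^sub>R p i)"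
      by (simp add: algebra_simps)
    also have "\<dots> = p i" using d by simp
    finally show ?thesis using True assms(1,3) by (simp add: simplex_maps_def)
  next
    case False
    then show ?thesis
      using assms(1,3) that by (simp add: simplex_maps_def opposite_centroid_eq d_def P_def)
  qed
  \<comment> \<open>An affine map commutes with combinations whose weights sum to 1.\<close>
  have "F i B = (\<Sum>j<k. x j *\<^sub>R L (p j)) + (\<Sum>j<k. x j) *\<^sub>R c"
    using x by (simp add: F B_def barycentric_def linear_sum[OF L] linear_cmul[OF L])
  also have "\<dots> = (\<Sum>j<k. x j *\<^sub>R F i (p j))"
    by (simp add: F scaleR_add_right sum.distrib scaleR_sum_left)
  also have "\<dots> = (\<Sum>j<k. (1 / d) *\<^sub>R (x j *\<^sub>R P) - (1 / d) *\<^sub>R (x j *\<^sub>R p j)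
      + (if j = i then (x i / d) *\<^sub>R (real k *\<^sub>R p i - P) else 0))"
    by (intro sum.cong refl) (auto simp: Fp algebra_simps)
  also have "\<dots> = (1 / d) *\<^sub>R ((\<Sum>j<k. x j) *\<^sub>R P) - (1 / d) *\<^sub>R B
      + (x i / d) *\<^sub>R (real k *\<^sub>R p i - P)"
    using assms(3)
    by (simp only: sum.distrib sum_subtractf B_def barycentric_def scaleR_sum_right
        scaleR_sum_left sum.delta finite_lessThan lessThan_iff if_True)
  also have "\<dots> = (1 / d) *\<^sub>R P - (1 / d) *\<^sub>R B + (x i / d) *\<^sub>R (real k *\<^sub>R p i - P)"
    using x by simp
  finally have 1: "F i B = (1 / d) *\<^sub>R P - (1 / d) *\<^sub>R B + (x i / d) *\<^sub>R (real k *\<^sub>R p i - P)" .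
  have "barycentric k p (cell_weights k i x)
      = (\<Sum>l<k. ((1 - x i) / d) *\<^sub>R p l - (1 / d) *\<^sub>R (x l *\<^sub>R p l)
          + (if l = i then (x i / d) *\<^sub>R (real k *\<^sub>R p i) else 0))"
    unfolding barycentric_def
  proof (intro sum.cong refl)
    fix l
    have "cell_weights k i x l = (1 - x i) / d - 1 / d * x l + (if l = i then x i / d * real k else 0)"
      by (simp add: cell_weights_def d_def diff_divide_distrib add_divide_distrib)
    thus "cell_weights k i x l *\<^sub>R p l = ((1 - x i) / d) *\<^sub>R p l - (1 / d) *\<^sub>R (x l *\<^sub>R p l)
        + (if l = i then (x i / d) *\<^sub>R (real k *\<^sub>R p i) else 0)"
      by (simp only: scaleR_add_left scaleR_diff_left scaleR_scaleR) simp
  qed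
  also have "\<dots> = ((1 - x i) / d) *\<^sub>R P - (1 / d) *\<^sub>R B + (x i / d) *\<^sub>R (real k *\<^sub>R p i)"
    using assms(3)
    by (simp only: sum.distrib sum_subtractf B_def P_def barycentric_def scaleR_sum_right
        sum.delta finite_lessThan lessThan_iff if_True)
  finally show ?thesis
    unfolding B_def[symmetric] 1 by (simp add: diff_divide_distrib algebra_simps)
qed

lemma cell_weights_simplex_weights:
  assumes "2 \<le> k" and "i < k" and "x \<in> simplex_weights k"
  shows "cell_weights k i x \<in> simplex_weights k"
proof -
  have nn: "\<And>j. j < k \<Longrightarrow> 0 \<le> x j" and s: "(\<Sum>j<k. x j) = 1"
    using assms(3) by (auto simp: simplex_weights_def)
  have d: "real k - 1 > 0" using assms(1) by simp
  have two: "x i + x j \<le> 1" if "j < k" "j \<noteq> i" for j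
  proof -
    have "sum x {i, j} \<le> (\<Sum>j<k. x j)"
      using that assms(2) nn by (intro sum_mono2) auto
    thus ?thesis using that s by simp
  qed
  have "0 \<le> cell_weights k i x l" if "l < k" for l
  proof (cases "l = i")
    case True
    have "2 * x i \<le> real k * x i"
      using nn[OF assms(2)] assms(1) by (intro mult_right_mono) auto
    with True d show ?thesis by (simp add: cell_weights_def)
  next
    case False
    with d two[OF that False] show ?thesis by (simp add: cell_weights_def)
  qed
  moreover have "(\<Sum>l<k. cell_weights k i x l) = 1"
  proof -
    have "(\<Sum>l<k. cell_weights k i x l)
        = (\<Sum>l<k. 1 - x i - x l + (if l = i then real k * x i else 0)) / (real k - 1)"
      by (simp add: cell_weights_def flip: sum_divide_distrib)
    also have "(\<Sum>l<k. 1 - x i - x l + (if l = i then real k * x i else 0)) = real k - 1"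
      using assms(2) s by (simp add: sum.distrib sum_subtractf algebra_simps)
    finally show ?thesis using d by simp
  qed
  ultimately show ?thesis by (simp add: simplex_weights_def)
qed

text \<open>The \<open>i\<close>-th coordinate of the image determines \<open>x\<^sub>i\<close>, because \<open>k \<noteq> 2\<close>; the other coordinates then
  determine the remaining weights.\<close>

lemma cell_weights_inject:
  assumes "3 \<le> k" and "i < k"
    and eq: "\<And>l. l < k \<Longrightarrow> cell_weights k i x l = cell_weights k i y l" and "l < k"
  shows "x l = y l"
proof -
  have e: "1 - x i - x l + (if l = i then real k * x i else 0)
      = 1 - y i - y l + (if l = i then real k * y i else 0)" if "l < k" for l
    using eq[OF that] assms(1) by (simp add: cell_weights_def)
  have "(real k - 2) * x i = (real k - 2) * y i"
    using e[OF assms(2)] by (simp add: algebra_simps)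
  hence "x i = y i" using assms(1) by simp
  thus ?thesis using e[OF assms(4)] by (cases "l = i") auto
qed

text \<open>Comparing the \<open>i\<close>-th coordinates gives \<open>(k - 2) x\<^sub>i = - (y\<^sub>i + y\<^sub>j)\<close>, and all weights are
  nonnegative. The \<open>j\<close>-th coordinates are symmetric.\<close>

lemma cell_weights_overlap:
  assumes "3 \<le> k" and "i < k" and "j < k" and "i \<noteq> j"
    and "x \<in> simplex_weights k" and "y \<in> simplex_weights k"
    and eq: "\<And>l. l < k \<Longrightarrow> cell_weights k i x l = cell_weights k j y l"
  shows "x i = 0" and "x j = 0" and "y i = 0" and "y j = 0"
proof -
  have nn: "0 \<le> x i" "0 \<le> x j" "0 \<le> y i" "0 \<le> y j"
    using assms(2,3,5,6) by (auto simp: simplex_weights_def)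
  have e: "1 - x i - x l + (if l = i then real k * x i else 0)
      = 1 - y j - y l + (if l = j then real k * y j else 0)" if "l < k" for l
    using eq[OF that] assms(1) by (simp add: cell_weights_def)
  have k: "real k \<ge> 3" using assms(1) by simp
  have "3 * x i \<le> real k * x i" "3 * y j \<le> real k * y j"
    using nn k by (auto intro: mult_right_mono)
  with nn e[OF assms(2)] e[OF assms(3)] assms(4)
  show "x i = 0" and "x j = 0" and "y i = 0" and "y j = 0" by auto
qed

section \<open>Overlaps of cells\<close>

lemma level_vertices_subset_simplex:
  assumes "simplex_maps k p F" and "2 \<le> k"
  shows "level_vertices k p F m \<subseteq> barycentric k p ` simplex_weights k"
proof (induction m)
  case 0
  have "p i \<in> barycentric k p ` simplex_weights k" if "i < k" for i
  proof
    let ?x = "\<lambda>j. if j = i then 1 else 0 :: real"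
    show "p i = barycentric k p ?x" using that by (intro barycentric_vertex[symmetric]) auto
    show "?x \<in> simplex_weights k" using that by (simp add: simplex_weights_def)
  qed
  thus ?case by auto
next
  case (Suc m)
  have "F i (barycentric k p x) \<in> barycentric k p ` simplex_weights k"
    if "i < k" "x \<in> simplex_weights k" for i x
    using simplex_maps_barycentric[OF assms that(1), of x] that
      cell_weights_simplex_weights[OF assms(2) that]
    by (simp add: simplex_weights_def)
  thus ?case using Suc.IH by fastforce
qed

text \<open>Geometrically, the vertices are the only points of \<open>V\<^sub>m\<close> on faces of codimension 2. Let
  \<open>z\<close> be the weights of a point whose image under \<open>F\<^sub>i\<close> has weights \<open>x\<close>. The \<open>i\<close>-th weight of the image is
  positive, so \<open>l, l' \<noteq> i\<close>, and vanishing of the weights at \<open>l\<close> and \<open>l'\<close> means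
  \<open>z\<^sub>i + z\<^sub>l = 1 = z\<^sub>i + z\<^sub>l\<^sub>'\<close>. As all weights sum to 1, this leaves only \<open>z\<^sub>i = 1\<close>, and \<open>F\<^sub>i\<close> fixes
  \<open>p\<^sub>i\<close>.\<close>

lemma level_vertices_two_zero_weights:
  fixes p :: "nat \<Rightarrow> 'a::real_vector"
  assumes p: "inj_on p {..<k}" "\<not> affine_dependent (p ` {..<k})"
    and maps: "simplex_maps k p F" and k: "3 \<le> k"
    and x: "x \<in> simplex_weights k" "barycentric k p x \<in> level_vertices k p F m"
    and l: "l < k" "l' < k" "l \<noteq> l'" "x l = 0" "x l' = 0"
  shows "barycentric k p x \<in> p ` {..<k}"
proof (cases m)
  case 0
  thus ?thesis using x by simp
next
  case (Suc n)
  then obtain i w where i: "i < k" and w: "w \<in> level_vertices k p F n"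
    and xw: "barycentric k p x = F i w"
    using x(2) by auto
  obtain z where z: "z \<in> simplex_weights k" "w = barycentric k p z"
    using level_vertices_subset_simplex[OF maps, of n] k w by auto
  have nn: "\<And>j. j < k \<Longrightarrow> 0 \<le> z j" and sz: "(\<Sum>j<k. z j) = 1" and sx: "(\<Sum>j<k. x j) = 1"
    using x z by (auto simp: simplex_weights_def)
  have c: "cell_weights k i z \<in> simplex_weights k"
    using cell_weights_simplex_weights k i z by simp
  have xc: "x j = cell_weights k i z j" if "j < k" for j
  proof (rule barycentric_inject[OF p sx _ _ that])
    show "barycentric k p x = barycentric k p (cell_weights k i z)"
      using simplex_maps_barycentric[OF maps _ i sz] k xw z by simp
    show "(\<Sum>j<k. cell_weights k i z j) = 1" using c by (simp add: simplex_weights_def)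
  qed
  have k': "3 \<le> real k" using k by simp
  have "3 * z i \<le> real k * z i" using k' nn[OF i] by (intro mult_right_mono) auto
  hence "cell_weights k i z i \<noteq> 0" using k' nn[OF i] by (simp add: cell_weights_def)
  hence ne: "l \<noteq> i" "l' \<noteq> i" using l xc by auto
  have one: "z i + z l = 1" "z i + z l' = 1"
    using l xc[of l] xc[of l'] ne k' by (auto simp: cell_weights_def)
  have "sum z {i, l, l'} \<le> (\<Sum>j<k. z j)"
    using l i nn by (intro sum_mono2) auto
  hence "z i + z l + z l' \<le> 1" using ne l sz by simp
  hence zi: "z i = 1" using one nn[OF l(1)] nn[OF l(2)] by linarith
  have "z j = 0" if "j < k" "j \<noteq> i" for j
  proof -
    have "sum z {i, j} \<le> (\<Sum>j<k. z j)"
      using that i nn by (intro sum_mono2) auto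
    thus ?thesis using that zi sz nn[OF that(1)] by simp
  qed
  hence "w = p i" unfolding z using zi i by (intro barycentric_vertex) auto
  thus ?thesis using i maps xw by (simp add: simplex_maps_def)
qed

lemma simplex_maps_inj_on:
  assumes "inj_on p {..<k}" and "\<not> affine_dependent (p ` {..<k})"
    and "simplex_maps k p F" and "3 \<le> k" and "i < k"
  shows "inj_on (F i) (level_vertices k p F m)"
proof (rule inj_onI)
  fix v w assume v: "v \<in> level_vertices k p F m" and w: "w \<in> level_vertices k p F m"
    and eq: "F i v = F i w"
  have "2 \<le> k" using assms(4) by simp
  note weights = subsetD[OF level_vertices_subset_simplex[OF assms(3) this]]
  from weights[OF v] obtain x where x: "v = barycentric k p x" "x \<in> simplex_weights k"
    by (rule imageE)
  from weights[OF w] obtain y where y: "w = barycentric k p y" "y \<in> simplex_weights k"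
    by (rule imageE)
  have sx: "(\<Sum>j<k. x j) = 1" and sy: "(\<Sum>j<k. y j) = 1"
    using x y by (auto simp: simplex_weights_def)
  have c: "cell_weights k i x \<in> simplex_weights k" "cell_weights k i y \<in> simplex_weights k"
    using cell_weights_simplex_weights assms(4,5) x y by auto
  have "barycentric k p (cell_weights k i x) = barycentric k p (cell_weights k i y)"
    using eq simplex_maps_barycentric[OF assms(3) _ assms(5)] sx sy assms(4) x(1) y(1)
    by simp
  hence "cell_weights k i x l = cell_weights k i y l" if "l < k" for l
    using barycentric_inject[OF assms(1,2)] c that by (simp add: simplex_weights_def)
  hence "x l = y l" if "l < k" for l using cell_weights_inject[OF assms(4,5)] that by blast
  thus "v = w" using x y by (simp add: barycentric_def)
qed

lemma simplex_maps_overlap: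
  assumes "inj_on p {..<k}" and "\<not> affine_dependent (p ` {..<k})"
    and "simplex_maps k p F" and "3 \<le> k" and "i < k" and "j < k" and "i \<noteq> j"
    and v: "v \<in> level_vertices k p F m" and w: "w \<in> level_vertices k p F m"
    and eq: "F i v = F j w"
  shows "v \<in> p ` {..<k}" and "w \<in> p ` {..<k}"
proof -
  have "2 \<le> k" using assms(4) by simp
  note weights = subsetD[OF level_vertices_subset_simplex[OF assms(3) this]]
  from weights[OF v] obtain x where x: "v = barycentric k p x" "x \<in> simplex_weights k"
    by (rule imageE)
  from weights[OF w] obtain y where y: "w = barycentric k p y" "y \<in> simplex_weights k"
    by (rule imageE)
  have sx: "(\<Sum>j<k. x j) = 1" and sy: "(\<Sum>j<k. y j) = 1"
    using x y by (auto simp: simplex_weights_def)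
  have c: "cell_weights k i x \<in> simplex_weights k" "cell_weights k j y \<in> simplex_weights k"
    using cell_weights_simplex_weights assms(4-6) x y by auto
  have "barycentric k p (cell_weights k i x) = barycentric k p (cell_weights k j y)"
    using eq simplex_maps_barycentric[OF assms(3) _ assms(5)]
      simplex_maps_barycentric[OF assms(3) _ assms(6)] sx sy assms(4) x(1) y(1)
    by simp
  hence "cell_weights k i x l = cell_weights k j y l" if "l < k" for l
    using barycentric_inject[OF assms(1,2)] c that by (simp add: simplex_weights_def)
  note * = cell_weights_overlap[OF assms(4-7) x(2) y(2) this]
  show "v \<in> p ` {..<k}" 
    using level_vertices_two_zero_weights[OF assms(1-4), of x m i j] * x v assms(5-7) by simp
  show "w \<in> p ` {..<k}" 
    using level_vertices_two_zero_weights[OF assms(1-4), of y m i j] * y w assms(5-7) by simp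
qed

lemma level_vertices_mono:
  assumes "simplex_maps k p F"
  shows "level_vertices k p F m \<subseteq> level_vertices k p F (Suc m)"
proof (induction m)
  case 0
  have "p i = F i (p i)" if "i < k" for i using assms that by (simp add: simplex_maps_def)
  thus ?case by fastforce
next
  case (Suc m)
  thus ?case by fastforce
qed

lemma vertices_subset_level_vertices:
  assumes "simplex_maps k p F"
  shows "p ` {..<k} \<subseteq> level_vertices k p F m"
  using lift_Suc_mono_le[of "level_vertices k p F" 0 m, OF level_vertices_mono[OF assms]]
  by simp

text \<open>A vertex has exactly one nonzero barycentric coordinate, whereas \<open>q\<^sub>i\<close> has \<open>k - 1 \<ge> 2\<close> of them.\<close>

lemma opposite_centroids_distinct:
  fixes p :: "nat \<Rightarrow> 'a::real_vector"
  assumes "inj_on p {..<k}" and "\<not> affine_dependent (p ` {..<k})" and "3 \<le> k"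
  shows "inj_on (opposite_centroid k p) {..<k}"
    and "i < k \<Longrightarrow> opposite_centroid k p i \<notin> p ` {..<k}"
proof -
  show "inj_on (opposite_centroid k p) {..<k}"
  proof (rule inj_onI)
    fix i j assume ij: "i \<in> {..<k}" "j \<in> {..<k}" "opposite_centroid k p i = opposite_centroid k p j"
    hence "p i = p j" using assms(3) by (simp add: opposite_centroid_eq)
    thus "i = j" using assms(1) ij by (auto dest: inj_onD)
  qed
next
  assume i: "i < k"
  show "opposite_centroid k p i \<notin> p ` {..<k}"
  proof
    assume "opposite_centroid k p i \<in> p ` {..<k}"
    then obtain j where j: "j < k" "opposite_centroid k p i = p j" by auto
    let ?x = "\<lambda>l. if l = i then 0 else 1 / (real k - 1)"
    let ?y = "\<lambda>l. if l = j then 1 else 0 :: real"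
    have x: "barycentric k p ?x = opposite_centroid k p i"
    proof -
      have "barycentric k p ?x = (\<Sum>l<k. (1 / (real k - 1)) *\<^sub>R p l
          - (if l = i then (1 / (real k - 1)) *\<^sub>R p i else 0))"
        unfolding barycentric_def by (intro sum.cong) auto
      thus ?thesis using i
        by (simp add: opposite_centroid_eq sum_subtractf scaleR_diff_right flip: scaleR_sum_right)
    qed
    have y: "barycentric k p ?y = p j" using j by (intro barycentric_vertex) auto
    have sx: "(\<Sum>l<k. ?x l) = 1"
    proof -
      have "(\<Sum>l<k. ?x l) = (\<Sum>l<k. 1 / (real k - 1) - (if l = i then 1 / (real k - 1) else 0))"
        by (intro sum.cong) auto
      also have "\<dots> = real k / (real k - 1) - 1 / (real k - 1)" using i by (simp add: sum_subtractf)
      also have "\<dots> = 1" using assms(3) by (simp add: diff_divide_distrib[symmetric])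
      finally show ?thesis .
    qed
    have sy: "(\<Sum>l<k. ?y l) = 1" using j by simp
    \<comment> \<open>At a third index the weight of \<open>q\<^sub>i\<close> is nonzero and that of \<open>p\<^sub>j\<close> is zero.\<close>
    have "card ({..<k} - {i, j}) > 0"
    proof -
      have "card {i, j} \<le> 2" by (simp add: card_insert_if)
      thus ?thesis using assms(3) diff_card_le_card_Diff[of "{i, j}" "{..<k}"] by simp
    qed
    then obtain l where l: "l < k" "l \<noteq> i" "l \<noteq> j" by (auto simp: card_gt_0_iff)
    have "?x l = ?y l"
      using barycentric_inject[OF assms(1,2) sx sy _ l(1)] x y j by simp
    thus False using l assms(3) by simp
  qed
qed

section \<open>The renormalization at the first level\<close>

definition complete_energy :: "nat \<Rightarrow> (nat \<Rightarrow> real) \<Rightarrow> real" where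
  "complete_energy k x = (\<Sum>j<k. \<Sum>i<j. (x i - x j)\<^sup>2)"

lemma complete_energy_eq:
  "complete_energy k x = real k * (\<Sum>i<k. (x i)\<^sup>2) - (\<Sum>i<k. x i)\<^sup>2"
proof (induction k)
  case 0
  show ?case by (simp add: complete_energy_def)
next
  case (Suc k)
  have "(\<Sum>i<k. (x i - x k)\<^sup>2)
      = (\<Sum>i<k. (x i)\<^sup>2) + real k * (x k)\<^sup>2 - 2 * x k * (\<Sum>i<k. x i)"
    by (simp add: power2_diff sum.distrib sum_subtractf sum_distrib_left mult_ac)
  moreover have "complete_energy (Suc k) x = complete_energy k x + (\<Sum>i<k. (x i - x k)\<^sup>2)"
    by (simp add: complete_energy_def)
  ultimately show ?case using Suc.IH by (simp add: power2_sum algebra_simps)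
qed

lemma complete_energy_nonneg: "0 \<le> complete_energy k x"
  by (simp add: complete_energy_def sum_nonneg)

text \<open>The solution of the linear system that expresses that the first-level energy is stationary at
  every \<open>q\<^sub>j\<close>, namely
  \<open>\<Sum>\<^sub>i\<^sub>\<noteq>\<^sub>j (y\<^sub>j - x\<^sub>i) + (k - 2) \<Sum>\<^sub>l (y\<^sub>j - y\<^sub>l) = 0\<close>. Summing these equations over \<open>j\<close> shows
  \<open>\<Sum>y = \<Sum>x\<close>, after which each equation contains only the unknown \<open>y\<^sub>j\<close>.\<close>

definition harmonic_value :: "nat \<Rightarrow> (nat \<Rightarrow> real) \<Rightarrow> nat \<Rightarrow> real" where
  "harmonic_value k x j = ((real k - 1) * (\<Sum>i<k. x i) - x j) / ((real k)\<^sup>2 - real k - 1)"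

lemma sum_if_eq_other:
  fixes f :: "nat \<Rightarrow> real"
  assumes "i < k"
  shows "(\<Sum>j<k. if j = i then a else f j) = (\<Sum>j<k. f j) - f i + a"
proof -
  have "(\<Sum>j<k. if j = i then a else f j) = (\<Sum>j<k. f j + (if j = i then a - f i else 0))"
    by (intro sum.cong) auto
  thus ?thesis using assms by (simp add: sum.distrib)
qed

lemma renormalization_denominator_pos:
  assumes "3 \<le> k"
  shows "0 < (real k)\<^sup>2 - real k - 1"
proof -
  have "3 * real k \<le> (real k)\<^sup>2"
    using assms unfolding power2_eq_square by (intro mult_right_mono) auto
  moreover have "3 \<le> real k" using assms by simp
  ultimately show ?thesis by linarith
qed

text \<open>Completing the square at the harmonic extension. An edge \<open>p\<^sub>i q\<^sub>j\<close> lies in one cell and an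
  edge \<open>q\<^sub>j q\<^sub>l\<close> in \<open>k - 2\<close> cells, whence the coefficients of the form in the deviation \<open>z\<close>:
  the vertex \<open>q\<^sub>j\<close> has \<open>k - 1\<close> neighbours among the \<open>p\<^sub>i\<close>, at which the deviation is zero.
  There is no mixed term, because \<open>z = 0\<close> is a critical point.\<close>

lemma sum_cell_energies:
  fixes x y :: "nat \<Rightarrow> real"
  assumes "3 \<le> k"
  defines "z \<equiv> \<lambda>j. y j - harmonic_value k x j"
  shows "(\<Sum>i<k. complete_energy k (\<lambda>j. if j = i then x i else y j))
    = real k * (real k - 2) / ((real k)\<^sup>2 - real k - 1) * complete_energy k x
      + (real k - 1) * (\<Sum>j<k. (z j)\<^sup>2) + (real k - 2) * complete_energy k z"
proof -
  define n D where "n = real k" and "D = n\<^sup>2 - n - 1"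
  have D: "D \<noteq> 0" using renormalization_denominator_pos[OF assms(1)] by (simp add: D_def n_def)
  \<comment> \<open>Both sides depend only on the power sums of \<open>x\<close> and \<open>y\<close> and on their inner product, so
    that the claim becomes a polynomial identity in these five quantities and \<open>n\<close>.\<close>
  define X X2 Y Y2 P where "X = (\<Sum>j<k. x j)" and "X2 = (\<Sum>j<k. (x j)\<^sup>2)"
    and "Y = (\<Sum>j<k. y j)" and "Y2 = (\<Sum>j<k. (y j)\<^sup>2)" and "P = (\<Sum>j<k. x j * y j)"
  note defs = X_def X2_def Y_def Y2_def P_def
  have "complete_energy k (\<lambda>j. if j = i then x i else y j)
      = n * (Y2 - (y i)\<^sup>2 + (x i)\<^sup>2) - (Y - y i + x i)\<^sup>2" if "i < k" for i
    using sum_if_eq_other[OF that, of "x i" y] sum_if_eq_other[OF that, of "(x i)\<^sup>2" "\<lambda>j. (y j)\<^sup>2"]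
    by (simp add: complete_energy_eq if_distrib[of "\<lambda>t. t\<^sup>2"] n_def Y_def Y2_def)
  hence "(\<Sum>i<k. complete_energy k (\<lambda>j. if j = i then x i else y j))
      = (\<Sum>i<k. n * (Y2 - (y i)\<^sup>2 + (x i)\<^sup>2) - (Y - y i + x i)\<^sup>2)"
    by (intro sum.cong) auto
  also have "\<dots> = (\<Sum>i<k. (n * Y2 - Y\<^sup>2) - (n + 1) * (y i)\<^sup>2 + (n - 1) * (x i)\<^sup>2
      + 2 * Y * y i - 2 * Y * x i + 2 * (x i * y i))"
    by (intro sum.cong refl) (simp add: power2_eq_square algebra_simps)
  also have "\<dots> = n * (n * Y2 - Y\<^sup>2) - (n + 1) * Y2 + (n - 1) * X2 + 2 * Y * Y - 2 * Y * X + 2 * P"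
    by (simp add: sum.distrib sum_subtractf defs n_def flip: sum_distrib_left)
  finally have lhs: "(\<Sum>i<k. complete_energy k (\<lambda>j. if j = i then x i else y j))
      = n * (n * Y2 - Y\<^sup>2) - (n + 1) * Y2 + (n - 1) * X2 + 2 * Y * Y - 2 * Y * X + 2 * P" .
  have zj: "z j = y j - ((n - 1) * X - x j) / D" for j
    by (simp add: z_def harmonic_value_def n_def D_def X_def)
  have "(\<Sum>j<k. z j) = Y - (n * ((n - 1) * X) - X) / D"
    by (simp add: zj sum_subtractf Y_def X_def n_def flip: sum_divide_distrib)
  also have "n * ((n - 1) * X) - X = D * X" by (simp add: D_def power2_eq_square algebra_simps)
  finally have Z: "(\<Sum>j<k. z j) = Y - X" using D by simp
  \<comment> \<open>Scaling by \<open>D\<^sup>2\<close> removes the denominators of the harmonic values.\<close>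
  have "D\<^sup>2 * (\<Sum>j<k. (z j)\<^sup>2) = (\<Sum>j<k. (D * y j - ((n - 1) * X - x j))\<^sup>2)"
  proof -
    have "D * z j = D * y j - ((n - 1) * X - x j)" for j
      unfolding zj using D by (simp only: right_diff_distrib) simp
    thus ?thesis by (simp add: sum_distrib_left flip: power_mult_distrib)
  qed
  also have "\<dots> = (\<Sum>j<k. D\<^sup>2 * (y j)\<^sup>2 + (n - 1)\<^sup>2 * X\<^sup>2 + (x j)\<^sup>2 - 2 * D * (n - 1) * X * y j
      + 2 * D * (x j * y j) - 2 * (n - 1) * X * x j)"
    by (intro sum.cong refl) (simp add: power2_eq_square algebra_simps)
  also have "\<dots> = D\<^sup>2 * Y2 + n * ((n - 1)\<^sup>2 * X\<^sup>2) + X2 - 2 * D * (n - 1) * X * Y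
      + 2 * D * P - 2 * (n - 1) * X * X"
    by (simp add: sum.distrib sum_subtractf defs n_def flip: sum_distrib_left)
  finally have Z2: "D\<^sup>2 * (\<Sum>j<k. (z j)\<^sup>2) = \<dots>" .
  define Q where "Q = (\<Sum>j<k. (z j)\<^sup>2)"
  define T where "T = n * (n * Y2 - Y\<^sup>2) - (n + 1) * Y2 + (n - 1) * X2 + 2 * Y * Y - 2 * Y * X + 2 * P"
  have "D * T = n * (n - 2) * (n * X2 - X\<^sup>2) + D\<^sup>2 * Q - D * (n - 2) * (Y - X)\<^sup>2"
    unfolding T_def Q_def Z2 unfolding D_def by (simp add: power2_eq_square algebra_simps)
  hence "T = (n * (n - 2) * (n * X2 - X\<^sup>2) + D\<^sup>2 * Q - D * (n - 2) * (Y - X)\<^sup>2) / D"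
    using D by (simp add: nonzero_eq_divide_eq mult.commute)
  also have "\<dots> = n * (n - 2) / D * (n * X2 - X\<^sup>2) + (D * Q - (n - 2) * (Y - X)\<^sup>2)"
    using D by (simp add: add_divide_distrib diff_divide_distrib power2_eq_square)
  also have "D * Q - (n - 2) * (Y - X)\<^sup>2 = (n - 1) * Q + (n - 2) * (n * Q - (Y - X)\<^sup>2)"
    by (simp add: D_def power2_eq_square algebra_simps)
  finally show ?thesis
    unfolding lhs T_def[symmetric] unfolding complete_energy_eq Z Q_def[symmetric]
    unfolding n_def[symmetric] X_def[symmetric] X2_def[symmetric] D_def[symmetric]
    by (simp only: add.assoc)
qed

section \<open>Self-similar energies\<close>

primrec self_similar_energy ::
    "nat \<Rightarrow> (nat \<Rightarrow> 'a) \<Rightarrow> (nat \<Rightarrow> 'a \<Rightarrow> 'a) \<Rightarrow> (nat \<Rightarrow> nat \<Rightarrow> real) \<Rightarrow> (nat \<Rightarrow> real) \<Rightarrow>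
     nat \<Rightarrow> ('a \<Rightarrow> real) \<Rightarrow> real" where
  "self_similar_energy k p F c r 0 = initial_energy k p c"
| "self_similar_energy k p F c r (Suc m) = (\<lambda>u. \<Sum>i<k. inverse (r i) *
     self_similar_energy k p F c r m (compose (level_vertices k p F m) u (F i)))"

text \<open>Existence and uniqueness of the minimizing extension together with equality of the energies, as
  one condition: every competitor other than \<open>v\<close> has strictly larger energy than \<open>u\<close>. In this
  form the condition passes through sums over cells.\<close>

definition strict_renormalization ::
    "'a set \<Rightarrow> 'a set \<Rightarrow> (('a \<Rightarrow> real) \<Rightarrow> real) \<Rightarrow> (('a \<Rightarrow> real) \<Rightarrow> real) \<Rightarrow> bool" where
  "strict_renormalization A B \<E> \<E>' \<longleftrightarrow>
     (\<forall>u \<in> A \<rightarrow>\<^sub>E UNIV. \<exists>v. v \<in> B \<rightarrow>\<^sub>E UNIV \<and> restrict v A = u \<and> \<E>' v = \<E> u \<and>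
        (\<forall>w \<in> B \<rightarrow>\<^sub>E UNIV. restrict w A = u \<longrightarrow> w \<noteq> v \<longrightarrow> \<E> u < \<E>' w))"

lemma strict_renormalization_minimizing_extension:
  assumes "strict_renormalization A B \<E> \<E>'" and "u \<in> A \<rightarrow>\<^sub>E UNIV"
  shows "\<exists>!v. minimizing_extension A B \<E>' u v"
    and "minimizing_extension A B \<E>' u v \<Longrightarrow> \<E>' v = \<E> u"
proof -
  from bspec[OF assms(1)[unfolded strict_renormalization_def] assms(2)]
  obtain h where h: "h \<in> B \<rightarrow>\<^sub>E UNIV" "restrict h A = u" "\<E>' h = \<E> u"
    and less: "\<forall>w \<in> B \<rightarrow>\<^sub>E UNIV. restrict w A = u \<longrightarrow> w \<noteq> h \<longrightarrow> \<E> u < \<E>' w"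
    by (elim exE conjE)
  have "minimizing_extension A B \<E>' u h"
    unfolding minimizing_extension_def is_arg_min_def
  proof (intro conjI notI)
    assume "\<exists>w. (w \<in> B \<rightarrow>\<^sub>E UNIV \<and> restrict w A = u) \<and> \<E>' w < \<E>' h"
    then obtain w where w: "w \<in> B \<rightarrow>\<^sub>E UNIV" "restrict w A = u" "\<E>' w < \<E>' h" by blast
    thus False using bspec[OF less w(1)] h(3) by (cases "w = h") auto
  qed (fact h)+
  moreover have eq: "v = h" if "minimizing_extension A B \<E>' u v" for v
  proof -
    have v: "v \<in> B \<rightarrow>\<^sub>E UNIV" "restrict v A = u" and "\<not> \<E>' h < \<E>' v"
      using that h(1,2) unfolding minimizing_extension_def is_arg_min_def by blast+
    thus ?thesis using bspec[OF less v(1)] h(3) by auto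
  qed
  ultimately show "\<exists>!v. minimizing_extension A B \<E>' u v" by blast
  show "minimizing_extension A B \<E>' u v \<Longrightarrow> \<E>' v = \<E> u" using eq h by blast
qed

text \<open>Prescribing a function on every cell defines a function on the union once the prescriptions
  agree on overlaps; injectivity rules out a conflict within a single cell.\<close>

lemma glue_cell_functions:
  assumes inj: "\<And>i. i < k \<Longrightarrow> inj_on (F i) V"
    and overlap: "\<And>i j x y. i < k \<Longrightarrow> j < k \<Longrightarrow> i \<noteq> j \<Longrightarrow> x \<in> V \<Longrightarrow> y \<in> V \<Longrightarrow> F i x = F j y
      \<Longrightarrow> h i x = h j y"
    and h: "\<And>i. i < k \<Longrightarrow> h i \<in> V \<rightarrow>\<^sub>E UNIV"
  obtains v where "v \<in> (\<Union>i<k. F i ` V) \<rightarrow>\<^sub>E UNIV" and "\<And>i. i < k \<Longrightarrow> compose V v (F i) = h i"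
proof -
  define v where "v = restrict
    (\<lambda>y. THE a. \<exists>i x. i < k \<and> x \<in> V \<and> y = F i x \<and> a = h i x) (\<Union>i<k. F i ` V)"
  have v: "v (F i x) = h i x" if "i < k" "x \<in> V" for i x
  proof -
    have "(THE a. \<exists>j y. j < k \<and> y \<in> V \<and> F i x = F j y \<and> a = h j y) = h i x"
    proof (rule the_equality)
      show "\<exists>j y. j < k \<and> y \<in> V \<and> F i x = F j y \<and> h i x = h j y" using that by blast
    next
      fix a assume "\<exists>j y. j < k \<and> y \<in> V \<and> F i x = F j y \<and> a = h j y"
      then obtain j y where j: "j < k" "y \<in> V" "F i x = F j y" "a = h j y" by blast
      show "a = h i x"
      proof (cases "i = j")
        case True
        thus ?thesis using j that inj[OF that(1)] by (auto dest: inj_onD)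
      next
        case False
        thus ?thesis using overlap[OF that(1) j(1) False that(2) j(2,3)] j(4) by simp
      qed
    qed
    moreover have "F i x \<in> (\<Union>i<k. F i ` V)" using that by blast
    ultimately show ?thesis by (simp add: v_def)
  qed
  have "compose V v (F i) = h i" if "i < k" for i
    using h[OF that] v[OF that] by (auto simp: compose_def fun_eq_iff PiE_def extensional_def)
  moreover have "v \<in> (\<Union>i<k. F i ` V) \<rightarrow>\<^sub>E UNIV" unfolding v_def by auto
  ultimately show ?thesis using that by blast
qed

text \<open>The minimization decouples over the cells: the restriction of a competitor to a cell is a
  competitor for the restriction of \<open>u\<close> to that cell, with energy at least the one of the cell
  minimizer. A competitor that differs from the glued cell minimizers differs in some cell, and
  there the inequality is strict. The overlap hypothesis places the common points of two cells
  among the images of \<open>V\<^sub>m\<close>, where the cell minimizers take the values of \<open>u\<close>.\<close>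

lemma strict_renormalization_Suc:
  fixes k p F c r
  defines "V \<equiv> level_vertices k p F" and "\<E> \<equiv> self_similar_energy k p F c r"
  assumes r: "\<And>i. i < k \<Longrightarrow> 0 < r i"
    and mono: "V m \<subseteq> V (Suc m)"
    and inj: "\<And>i. i < k \<Longrightarrow> inj_on (F i) (V (Suc m))"
    and overlap: "\<And>i j x y. i < k \<Longrightarrow> j < k \<Longrightarrow> i \<noteq> j \<Longrightarrow> x \<in> V (Suc m) \<Longrightarrow> y \<in> V (Suc m)
      \<Longrightarrow> F i x = F j y \<Longrightarrow> x \<in> V m \<and> y \<in> V m"
    and IH: "strict_renormalization (V m) (V (Suc m)) (\<E> m) (\<E> (Suc m))"
  shows "strict_renormalization (V (Suc m)) (V (Suc (Suc m))) (\<E> (Suc m)) (\<E> (Suc (Suc m)))"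
  unfolding strict_renormalization_def
proof
  fix u assume u: "u \<in> V (Suc m) \<rightarrow>\<^sub>E (UNIV :: real set)"
  have VSuc: "V (Suc n) = (\<Union>i<k. F i ` V n)" for n by (simp add: V_def)
  have ESuc: "\<E> (Suc n) w = (\<Sum>i<k. inverse (r i) * \<E> n (compose (V n) w (F i)))" for n w
    by (simp add: \<E>_def V_def)
  define cell where "cell i = compose (V m) u (F i)" for i
  define minimal where "minimal i h \<longleftrightarrow> h \<in> V (Suc m) \<rightarrow>\<^sub>E UNIV \<and> restrict h (V m) = cell i \<and>
      \<E> (Suc m) h = \<E> m (cell i) \<and> (\<forall>w \<in> V (Suc m) \<rightarrow>\<^sub>E UNIV. restrict w (V m) = cell i \<longrightarrow> w \<noteq> h \<longrightarrow>
        \<E> m (cell i) < \<E> (Suc m) w)" for i h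
  have "\<exists>h. minimal i h" for i
  proof -
    have "cell i \<in> V m \<rightarrow>\<^sub>E UNIV" by (simp add: cell_def compose_def)
    from bspec[OF IH[unfolded strict_renormalization_def] this] show ?thesis
      unfolding minimal_def .
  qed
  then obtain h where minimal: "\<And>i. minimal i (h i)" by metis
  have h: "h i \<in> V (Suc m) \<rightarrow>\<^sub>E UNIV" "restrict (h i) (V m) = cell i"
      "\<E> (Suc m) (h i) = \<E> m (cell i)"
    and less: "\<And>w. w \<in> V (Suc m) \<rightarrow>\<^sub>E UNIV \<Longrightarrow> restrict w (V m) = cell i \<Longrightarrow> w \<noteq> h i
      \<Longrightarrow> \<E> m (cell i) < \<E> (Suc m) w" for i
    using minimal[of i] unfolding minimal_def by simp_all
  have hV: "h i x = u (F i x)" if "x \<in> V m" for i x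
    using fun_cong[OF h(2), of i x] that by (simp add: cell_def compose_def)
  obtain v where v: "v \<in> V (Suc (Suc m)) \<rightarrow>\<^sub>E UNIV"
    and cv: "\<And>i. i < k \<Longrightarrow> compose (V (Suc m)) v (F i) = h i"
  proof (rule glue_cell_functions[of k F "V (Suc m)" h])
    show "h i x = h j y"
      if "i < k" "j < k" "i \<noteq> j" "x \<in> V (Suc m)" "y \<in> V (Suc m)" "F i x = F j y" for i j x y
      using overlap[OF that] hV that(6) by simp
  qed (use inj h(1) in \<open>auto simp: VSuc[of "Suc m"]\<close>)
  have "restrict v (V (Suc m)) y = u y" for y
  proof (cases "y \<in> V (Suc m)")
    case True
    then obtain i x where x: "i < k" "x \<in> V m" "y = F i x" by (auto simp: VSuc)
    have "v (F i x) = h i x"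
      using fun_cong[OF cv[OF x(1)], of x] x(2) mono by (auto simp: compose_def)
    thus ?thesis using True x hV by simp
  qed (use u in \<open>auto simp: PiE_def extensional_def\<close>)
  hence vu: "restrict v (V (Suc m)) = u" by blast
  have Eu: "\<E> (Suc m) u = (\<Sum>i<k. inverse (r i) * \<E> m (cell i))" by (simp add: ESuc cell_def)
  have Ev: "\<E> (Suc (Suc m)) v = \<E> (Suc m) u"
    unfolding Eu ESuc[of "Suc m"] by (intro sum.cong) (auto simp: cv h(3))
  have "\<E> (Suc m) u < \<E> (Suc (Suc m)) w"
    if w: "w \<in> V (Suc (Suc m)) \<rightarrow>\<^sub>E UNIV" "restrict w (V (Suc m)) = u" "w \<noteq> v" for w
  proof -
    define wc where "wc i = compose (V (Suc m)) w (F i)" for i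
    have wc: "wc i \<in> V (Suc m) \<rightarrow>\<^sub>E UNIV" for i by (simp add: wc_def compose_def)
    have wcr: "restrict (wc i) (V m) = cell i" if "i < k" for i
    proof
      fix x
      have "w (F i x) = u (F i x)" if "x \<in> V m"
      proof -
        have "F i x \<in> V (Suc m)" using that \<open>i < k\<close> by (auto simp: VSuc)
        thus ?thesis using fun_cong[OF w(2), of "F i x"] by simp
      qed
      thus "restrict (wc i) (V m) x = cell i x"
        using mono by (auto simp: wc_def cell_def compose_def)
    qed
    have le: "\<E> m (cell i) \<le> \<E> (Suc m) (wc i)" if "i < k" for i
      using less[OF wc wcr[OF that]] h(3)[of i] by (cases "wc i = h i") (auto simp: less_imp_le)
    obtain y where y: "y \<in> V (Suc (Suc m))" "w y \<noteq> v y" using w(1,3) v by (metis PiE_ext)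
    then obtain i x where x: "i < k" "x \<in> V (Suc m)" "y = F i x"
      unfolding VSuc[of "Suc m"] by blast
    have "wc i x \<noteq> h i x"
      using fun_cong[OF cv[OF x(1)], of x] x y by (simp add: wc_def compose_def)
    hence lt: "\<E> m (cell i) < \<E> (Suc m) (wc i)" using less[OF wc wcr[OF x(1)]] by metis
    have "(\<Sum>i<k. inverse (r i) * \<E> m (cell i)) < (\<Sum>i<k. inverse (r i) * \<E> (Suc m) (wc i))"
    proof (rule sum_strict_mono_ex1)
      show "\<forall>i\<in>{..<k}. inverse (r i) * \<E> m (cell i) \<le> inverse (r i) * \<E> (Suc m) (wc i)"
        using le r by (auto intro: mult_left_mono simp: less_imp_le)
      show "\<exists>i\<in>{..<k}. inverse (r i) * \<E> m (cell i) < inverse (r i) * \<E> (Suc m) (wc i)"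
        using lt r x(1) by (intro bexI[of _ i]) auto
    qed simp
    thus ?thesis unfolding Eu ESuc[of "Suc m"] wc_def .
  qed
  with v vu Ev show "\<exists>v. v \<in> V (Suc (Suc m)) \<rightarrow>\<^sub>E UNIV \<and> restrict v (V (Suc m)) = u \<and>
      \<E> (Suc (Suc m)) v = \<E> (Suc m) u \<and>
      (\<forall>w \<in> V (Suc (Suc m)) \<rightarrow>\<^sub>E UNIV. restrict w (V (Suc m)) = u \<longrightarrow> w \<noteq> v \<longrightarrow>
        \<E> (Suc m) u < \<E> (Suc (Suc m)) w)"
    by blast
qed

text \<open>The values at the \<open>q\<^sub>j\<close> are independent of each other and of those at the \<open>p\<^sub>i\<close>, so
  the harmonic values define an extension, and by \<open>sum_cell_energies\<close> any deviation from them costs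
  energy.\<close>

lemma strict_renormalization_0:
  fixes k :: nat and p :: "nat \<Rightarrow> 'a::real_vector" and F :: "nat \<Rightarrow> 'a \<Rightarrow> 'a"
  defines "c \<equiv> \<lambda>i j :: nat. 1" and "r \<equiv> \<lambda>i :: nat. real k * (real k - 2) / ((real k)\<^sup>2 - real k - 1)"
  assumes "inj_on p {..<k}" and "\<not> affine_dependent (p ` {..<k})" and "3 \<le> k"
    and maps: "simplex_maps k p F"
  shows "strict_renormalization (level_vertices k p F 0) (level_vertices k p F (Suc 0))
    (self_similar_energy k p F c r 0) (self_similar_energy k p F c r (Suc 0))"
  unfolding strict_renormalization_def
proof
  fix u :: "'a \<Rightarrow> real"
  let ?V = "level_vertices k p F" and ?E = "self_similar_energy k p F c r"
  assume u: "u \<in> ?V 0 \<rightarrow>\<^sub>E UNIV"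
  define q where "q = opposite_centroid k p"
  define R where "R = real k * (real k - 2) / ((real k)\<^sup>2 - real k - 1)"
  have R: "R > 0" using renormalization_denominator_pos[OF assms(5)] assms(5) by (simp add: R_def)
  define x where "x i = u (p i)" for i
  have q: "inj_on q {..<k}" "\<And>i. i < k \<Longrightarrow> q i \<notin> p ` {..<k}"
    using opposite_centroids_distinct[OF assms(3-5)] by (auto simp: q_def)
  have Fp: "F i (p j) = (if j = i then p i else q j)" if "i < k" "j < k" for i j
    using maps that by (simp add: simplex_maps_def q_def)
  have V1: "?V (Suc 0) = p ` {..<k} \<union> q ` {..<k}"
  proof
    show "?V (Suc 0) \<subseteq> p ` {..<k} \<union> q ` {..<k}" by (auto simp: Fp)
    have "q j \<in> ?V (Suc 0)" if "j < k" for j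
    proof -
      \<comment> \<open>Some index other than \<open>j\<close>.\<close>
      define i where "i = (if j = 0 then 1 else 0 :: nat)"
      have "i < k" "i \<noteq> j" using assms(5) by (auto simp: i_def)
      thus ?thesis using Fp[of i j] that by force
    qed
    thus "p ` {..<k} \<union> q ` {..<k} \<subseteq> ?V (Suc 0)"
      using level_vertices_mono[OF maps, of 0] by auto
  qed
  have E0: "?E 0 w = complete_energy k (\<lambda>i. w (p i))" for w
    by (simp add: initial_energy_def complete_energy_def c_def)
  define z where "z w j = w (q j) - harmonic_value k x j" for w j
  have E1: "?E (Suc 0) w = ?E 0 u +
      ((real k - 1) * (\<Sum>j<k. (z w j)\<^sup>2) + (real k - 2) * complete_energy k (z w)) / R"
    if w: "restrict w (?V 0) = u" for w
  proof -
    have wp: "w (p i) = x i" if "i < k" for i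
      using fun_cong[OF w, of "p i"] that by (simp add: x_def)
    have "?E (Suc 0) w = (\<Sum>i<k. complete_energy k (\<lambda>j. if j = i then x i else w (q j))) / R"
    proof -
      have "?E 0 (compose (?V 0) w (F i)) = complete_energy k (\<lambda>j. if j = i then x i else w (q j))"
        if "i < k" for i
        unfolding E0 unfolding complete_energy_def using that
        by (intro sum.cong refl arg_cong[of _ _ "\<lambda>t. t\<^sup>2"]) (auto simp: compose_def Fp wp)
      moreover have "r = (\<lambda>i. R)" by (simp add: r_def R_def)
      ultimately show ?thesis
        by (simp add: sum_distrib_left divide_inverse mult.commute)
    qed
    also have "\<dots> = (R * complete_energy k x + ((real k - 1) * (\<Sum>j<k. (z w j)\<^sup>2)
        + (real k - 2) * complete_energy k (z w))) / R"
      unfolding sum_cell_energies[OF assms(5)] z_def R_def by simp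
    also have "complete_energy k x = ?E 0 u" unfolding E0 x_def ..
    finally show ?thesis using R by (simp add: add_divide_distrib)
  qed
  define v where "v = restrict (\<lambda>y. if y \<in> p ` {..<k} then u y
    else harmonic_value k x (the_inv_into {..<k} q y)) (?V (Suc 0))"
  have v: "v \<in> ?V (Suc 0) \<rightarrow>\<^sub>E UNIV" by (simp add: v_def)
  have vq: "v (q j) = harmonic_value k x j" if "j < k" for j
    using that q V1 by (auto simp: v_def the_inv_into_f_f)
  have vu: "restrict v (?V 0) = u"
    using u V1 by (auto simp: v_def fun_eq_iff PiE_def extensional_def)
  have "z v j = 0" if "j < k" for j by (simp add: z_def vq that)
  hence Ev: "?E (Suc 0) v = ?E 0 u" unfolding E1[OF vu] by (simp add: complete_energy_eq)
  have "?E 0 u < ?E (Suc 0) w"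
    if w: "w \<in> ?V (Suc 0) \<rightarrow>\<^sub>E UNIV" "restrict w (?V 0) = u" "w \<noteq> v" for w
  proof -
    obtain y where y: "y \<in> ?V (Suc 0)" "w y \<noteq> v y" using w(1,3) v by (metis PiE_ext)
    have "y \<notin> p ` {..<k}"
      using fun_cong[OF w(2), of y] fun_cong[OF vu, of y] y(2) by auto
    with y(1) obtain j where j: "j < k" "y = q j" unfolding V1 by auto
    hence "z w j \<noteq> 0" using y(2) vq by (simp add: z_def)
    hence "0 < (\<Sum>j<k. (z w j)\<^sup>2)" using j(1) by (intro sum_pos2[of _ j]) auto
    hence "0 < (real k - 1) * (\<Sum>j<k. (z w j)\<^sup>2)" using assms(5) by simp
    moreover have "0 \<le> (real k - 2) * complete_energy k (z w)"
      using assms(5) complete_energy_nonneg by simp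
    ultimately show ?thesis using R unfolding E1[OF w(2)] by simp
  qed
  with v vu Ev show "\<exists>v. v \<in> ?V (Suc 0) \<rightarrow>\<^sub>E UNIV \<and> restrict v (?V 0) = u \<and> ?E (Suc 0) v = ?E 0 u \<and>
      (\<forall>w \<in> ?V (Suc 0) \<rightarrow>\<^sub>E UNIV. restrict w (?V 0) = u \<longrightarrow> w \<noteq> v \<longrightarrow> ?E 0 u < ?E (Suc 0) w)"
    by blast
qed

theorem theorem5p2:
  fixes k :: nat
    and p :: "nat \<Rightarrow> real ^ 'n"
    and F :: "nat \<Rightarrow> real ^ 'n \<Rightarrow> real ^ 'n"
    and K :: "(real ^ 'n) set"
  assumes "k \<ge> 3"
    and "CARD('n) = k - 1"
    and "regular_simplex_vertices k p"
    and "simplex_maps k p F"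
    and "self_similar_set k F K"
  shows "renormalization_solution k p F (\<lambda>i j. 1)
           (\<lambda>i. (real k * (real k - 2)) / ((real k)\<^sup>2 - real k - 1))"
proof -
  have p: "inj_on p {..<k}" "\<not> affine_dependent (p ` {..<k})"
    using assms(3) by (auto simp: regular_simplex_vertices_def)
  define r :: "nat \<Rightarrow> real" where "r = (\<lambda>i. (real k * (real k - 2)) / ((real k)\<^sup>2 - real k - 1))"
  define \<E> where "\<E> = self_similar_energy k p F (\<lambda>i j. 1) r"
  let ?V = "level_vertices k p F"
  have r: "0 < r i" for i
    using renormalization_denominator_pos[OF assms(1)] assms(1) by (simp add: r_def)
  have renorm: "strict_renormalization (?V m) (?V (Suc m)) (\<E> m) (\<E> (Suc m))" for m
  proof (induction m)
    case 0
    show ?case unfolding \<E>_def r_def using p assms(1,4) by (rule strict_renormalization_0)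
  next
    case (Suc m)
    show ?case unfolding \<E>_def
    proof (rule strict_renormalization_Suc)
      show "x \<in> ?V m \<and> y \<in> ?V m"
        if "i < k" "j < k" "i \<noteq> j" "x \<in> ?V (Suc m)" "y \<in> ?V (Suc m)" "F i x = F j y" for i j x y
        using simplex_maps_overlap[OF p assms(4,1) that]
          vertices_subset_level_vertices[OF assms(4), of m] by blast
      show "strict_renormalization (?V m) (?V (Suc m)) (self_similar_energy k p F (\<lambda>i j. 1) r m)
          (self_similar_energy k p F (\<lambda>i j. 1) r (Suc m))"
        using Suc.IH unfolding \<E>_def .
    qed (rule r level_vertices_mono[OF assms(4)] simplex_maps_inj_on[OF p assms(4,1)]; assumption?)+
  qed
  show ?thesis
    unfolding renormalization_solution_def Let_def r_def[symmetric]
  proof (intro conjI exI[of _ \<E>] allI ballI impI)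
    show "\<E> 0 u = initial_energy k p (\<lambda>i j. 1) u" for u by (simp add: \<E>_def)
    show "\<E> (Suc m) u = (\<Sum>i<k. inverse (r i) * \<E> m (compose (?V m) u (F i)))" for m u
      by (simp add: \<E>_def)
  qed (use r strict_renormalization_minimizing_extension[OF renorm] in auto)
qed

end
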